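(* For an integer $h\ge 1$, let $T_h$ be the complete binary tree of height $h$. Then $$\gamma(T_h)=\left\lfloor\frac{2^{h+2}+3}{7}\right\rfloor,\qquad \zeta(T_h)=\begin{cases}3,& h\equiv 0\pmod 3\ \text{and } h\ge 3,\\ 1,&\text{otherwise}.\end{cases}$$
   Context: The complete binary tree $T_h$ of height $h$ is the rooted tree in which every vertex at distance less than $h$ from the root has exactly two children and the vertices at distance $h$ from the root are leaves; thus $|V(T_h)|=2^{h+1}-1$. It is regarded as a finite simple (undirected) graph. For a finite simple graph $G$, a set $D\subseteq V(G)$ is dominating if every vertex of $G$ lies in $D$ or has a neighbor in $D$. The domination number $\gamma(G)$ is the minimum size of a dominating set. The dominion $\zeta(G)$ is the number of dominating sets of $G$ of size $\gamma(G)$. *)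

theory Defs
  imports Complex_Main "Graph_Theory.Pair_Digraph"
begin

text \<open>
  A finite simple undirected graph is a pair digraph satisfying the locale
  \<^locale>\<open>pair_graph\<close>: every edge is represented by its two opposite arcs.
  As arcs are symmetric, the direction used below for "neighbour" is immaterial.
  The two numbers below are meaningful only for finite graphs, since \<^const>\<open>card\<close> is 0 on
  infinite sets.
\<close>

definition dominating_set :: "'a pair_pre_digraph \<Rightarrow> 'a set \<Rightarrow> bool" where
  "dominating_set G D \<longleftrightarrow>
     D \<subseteq> pverts G \<and> (\<forall>v \<in> pverts G. v \<in> D \<or> (\<exists>u \<in> D. (v, u) \<in> parcs G))"

definition domination_number :: "'a pair_pre_digraph \<Rightarrow> nat" where
  "domination_number G = (LEAST k. \<exists>D. dominating_set G D \<and> card D = k)"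

definition dominion :: "'a pair_pre_digraph \<Rightarrow> nat" where
  "dominion G = card {D. dominating_set G D \<and> card D = domination_number G}"

text \<open>
  A vertex of the complete binary tree is named by the sequence of left/right choices
  leading from it up to the root: the root is \<^term>\<open>[] :: bool list\<close>, the two children
  of \<open>v\<close> are \<open>False # v\<close> and \<open>True # v\<close>, and the distance of \<open>v\<close> from the root is the
  length of \<open>v\<close>.
\<close>

definition complete_binary_tree :: "nat \<Rightarrow> bool list pair_pre_digraph" where
  "complete_binary_tree h =
     \<lparr> pverts = {v. length v \<le> h},
       parcs = {(u, v). length u \<le> h \<and> length v \<le> h \<and> (\<exists>b. u = b # v \<or> v = b # u)} \<rparr>"

lemma finite_bool_lists_le: "finite {v :: bool list. length v \<le> h}"
  using finite_lists_length_le[of "UNIV :: bool set" h] by simp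

lemma pair_graph_complete_binary_tree: "pair_graph (complete_binary_tree h)"
proof
  show "finite (pverts (complete_binary_tree h))"
    by (simp add: complete_binary_tree_def finite_bool_lists_le)
  have "parcs (complete_binary_tree h) \<subseteq> {v. length v \<le> h} \<times> {v. length v \<le> h}"
    by (auto simp: complete_binary_tree_def)
  then show "finite (parcs (complete_binary_tree h))"
    by (rule finite_subset) (simp add: finite_bool_lists_le)
  show "symmetric (with_proj (complete_binary_tree h))"
    by (auto simp: symmetric_def sym_def arcs_ends_def arc_to_ends_def complete_binary_tree_def)
qed (auto simp: complete_binary_tree_def)

lemma card_pverts_complete_binary_tree:
  "card (pverts (complete_binary_tree h)) = 2 ^ (h + 1) - 1"
proof -
  have "card (pverts (complete_binary_tree h)) = (\<Sum>i\<le>h. 2 ^ i)"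
    using card_lists_length_le[of "UNIV :: bool set" h]
    by (simp add: complete_binary_tree_def)
  also have "\<dots> = 2 ^ (h + 1) - (1 :: nat)"
    by (induction h) auto
  finally show ?thesis .
qed

end

theory Submission
  imports Defs
begin

text \<open>
  Sort the sets \<open>D\<close> that dominate every vertex of \<open>T\<^sub>h\<close> except possibly the root into three
  classes: the root lies in \<open>D\<close>; it does not, but has a child in \<open>D\<close>; it is undominated.
  Splitting \<open>D\<close> along the two subtrees of the root expresses each class for height \<open>h + 1\<close> by
  products of the classes for height \<open>h\<close>. If the root is in \<open>D\<close>, both halves are arbitrary; in
  the second class both halves are dominating and at least one contains its root; in the third
  both halves are in the second class. Hence the minimum sizes and the numbers of minimum sets
  obey a recursion, whose solution has the shape \<open>q + 1, q + 1, q\<close> for \<open>h \<equiv> 0 (mod 3)\<close> with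
  counts \<open>1, 2, 1\<close> (for \<open>h > 0\<close>) and \<open>7 q + 4 = 2 ^ (h + 2)\<close>. For \<open>h \<equiv> 1\<close>
  only the first class attains \<open>\<gamma>\<close>, for \<open>h \<equiv> 2\<close> only the second one, and there the first class
  starts at \<open>\<gamma> + 1\<close> with a single set.
\<close>

section \<open>Splitting vertex sets along the two subtrees of the root\<close>

text \<open>Vertex names are read towards the root, so the last letter selects the subtree.\<close>
definition subtree :: "bool \<Rightarrow> bool list set \<Rightarrow> bool list set" where
  "subtree b D = {v. v @ [b] \<in> D}"

text \<open>\<open>r\<close> decides about the root. The halves form a pair so that whole classes
  become images of Cartesian products, where counts multiply.\<close>

definition join :: "bool \<Rightarrow> bool list set \<times> bool list set \<Rightarrow> bool list set" where
  "join r = (\<lambda>(L, R). (if r then {[]} else {}) \<union> (\<lambda>v. v @ [False]) ` L \<union> (\<lambda>v. v @ [True]) ` R)"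

lemma subtree_join [simp]:
  "subtree False (join r (L, R)) = L" "subtree True (join r (L, R)) = R"
  by (auto simp: subtree_def join_def)

lemma Nil_in_join [simp]: "[] \<in> join r p \<longleftrightarrow> r"
  by (auto simp: join_def split: prod.splits)

lemma join_subtree: "join ([] \<in> D) (subtree False D, subtree True D) = D"
proof (rule set_eqI)
  fix v
  show "v \<in> join ([] \<in> D) (subtree False D, subtree True D) \<longleftrightarrow> v \<in> D"
  proof (cases v rule: rev_cases)
    case (snoc w b)
    then show ?thesis by (cases b) (auto simp: join_def subtree_def)
  qed simp
qed

lemma inj_join: "inj (join r)"
proof (rule injI, clarify)
  fix L R L' R' assume "join r (L, R) = join r (L', R')"
  from arg_cong[OF this, of "subtree False"] arg_cong[OF this, of "subtree True"]
  show "L = L' \<and> R = R'"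
    by simp
qed

text \<open>Turns such an image into conditions on the root and the two halves, so that the
  recursions below only have to compare conditions.\<close>

lemma image_join:
  "join r ` S = {D. ([] \<in> D \<longleftrightarrow> r) \<and> (subtree False D, subtree True D) \<in> S}"
proof (intro equalityI subsetI)
  fix D assume "D \<in> {D. ([] \<in> D \<longleftrightarrow> r) \<and> (subtree False D, subtree True D) \<in> S}"
  then show "D \<in> join r ` S"
    using join_subtree[of D] by force
qed auto

lemma finite_join: "finite L \<Longrightarrow> finite R \<Longrightarrow> finite (join r (L, R))"
  by (simp add: join_def)

lemma card_join:
  assumes "finite L" "finite R"
  shows "card (join r (L, R)) = of_bool r + card L + card R"
proof -
  let ?L = "(\<lambda>v. v @ [False]) ` L" and ?R = "(\<lambda>v. v @ [True]) ` R"
  have "card (?L \<union> ?R) = card L + card R"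
    using assms by (subst card_Un_disjoint) (auto simp: card_image inj_on_def)
  moreover have "[] \<notin> ?L \<union> ?R"
    by auto
  ultimately show ?thesis
    using assms by (simp add: join_def)
qed

section \<open>Lower bounds on sizes and the number of sets attaining them\<close>

text \<open>The bound \<open>n\<close> need not be attained; then \<open>k = 0\<close>.\<close>
definition min_count :: "'a set set \<Rightarrow> nat \<Rightarrow> nat \<Rightarrow> bool" where
  "min_count P n k \<longleftrightarrow>
     finite P \<and> (\<forall>D\<in>P. finite D \<and> n \<le> card D) \<and> card {D \<in> P. card D = n} = k"

text \<open>Brings classes with different minima to a common bound, where those with a larger
  minimum contribute 0.\<close>

lemma min_count_less:
  assumes "min_count P n k" "m < n"
  shows "min_count P m 0"
proof -
  have "{D \<in> P. card D = m} = {}"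
    using assms by (auto simp: min_count_def)
  then show ?thesis
    using assms by (auto simp: min_count_def)
qed

lemma min_count_Un:
  assumes "min_count P n j" "min_count Q n k" "P \<inter> Q = {}"
  shows "min_count (P \<union> Q) n (j + k)"
proof -
  have "{D \<in> P \<union> Q. card D = n} = {D \<in> P. card D = n} \<union> {D \<in> Q. card D = n}"
    by auto
  also have "card \<dots> = j + k"
    using assms by (subst card_Un_disjoint) (auto simp: min_count_def)
  finally show ?thesis
    using assms by (auto simp: min_count_def)
qed

text \<open>Sizes add and each half respects its own bound, so the total is attained exactly when
  both halves attain theirs; \<open>inj_join\<close> then gives the product of the counts.\<close>

lemma min_count_join:
  assumes P: "min_count P m j" and Q: "min_count Q n k"
  shows "min_count (join r ` (P \<times> Q)) (of_bool r + m + n) (j * k)"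
proof -
  have P': "finite L \<and> m \<le> card L" if "L \<in> P" for L
    using that P unfolding min_count_def by blast
  have Q': "finite R \<and> n \<le> card R" if "R \<in> Q" for R
    using that Q unfolding min_count_def by blast
  define c where "c = of_bool r + m + n"
  have low: "finite (join r (L, R)) \<and> c \<le> card (join r (L, R))"
    and eq: "card (join r (L, R)) = c \<longleftrightarrow> card L = m \<and> card R = n"
    if "L \<in> P" "R \<in> Q" for L R
    using P'[OF that(1)] Q'[OF that(2)] by (simp_all add: c_def finite_join card_join, linarith)
  have "{D \<in> join r ` (P \<times> Q). card D = c} =
      join r ` ({D \<in> P. card D = m} \<times> {D \<in> Q. card D = n})"
    using eq by fastforce
  also have "card \<dots> = card ({D \<in> P. card D = m} \<times> {D \<in> Q. card D = n})"
    by (rule card_image[OF inj_on_subset[OF inj_join subset_UNIV]])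
  also have "\<dots> = j * k"
    using P Q by (simp add: card_cartesian_product min_count_def)
  finally have "card {D \<in> join r ` (P \<times> Q). card D = c} = j * k" .
  moreover have "finite (join r ` (P \<times> Q))"
    using P Q by (simp add: min_count_def)
  ultimately show ?thesis
    using low unfolding min_count_def c_def by blast
qed

text \<open>\<open>k > 0\<close> provides a dominating set of size \<open>n\<close>, which makes the
  lower bound the minimum.\<close>

lemma domination_number_dominion_eqI:
  assumes "min_count {D. dominating_set G D} n k" "k > 0"
  shows "domination_number G = n" "dominion G = k"
proof -
  have "{D. dominating_set G D \<and> card D = n} \<noteq> {}"
    using assms by (auto simp: min_count_def simp del: empty_Collect_eq Collect_empty_eq)
  then obtain D where "dominating_set G D" "card D = n"
    by blast
  then show "domination_number G = n"
    unfolding domination_number_def using assms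
    by (intro Least_equality) (auto simp: min_count_def)
  then show "dominion G = k"
    using assms by (simp add: dominion_def min_count_def)
qed

section \<open>The three classes of sets at the root\<close>

text \<open>\<open>tl v\<close> is the parent of \<open>v\<close>, and \<open>b # v\<close> are its
  children. The root is exempt because, inside a larger tree, its parent may dominate it.\<close>

definition almost_dominating :: "nat \<Rightarrow> bool list set \<Rightarrow> bool" where
  "almost_dominating h D \<longleftrightarrow> D \<subseteq> {v. length v \<le> h} \<and>
     (\<forall>v. v \<noteq> [] \<and> length v \<le> h \<longrightarrow> v \<in> D \<or> tl v \<in> D \<or> (\<exists>b. b # v \<in> D))"

definition root_taken :: "nat \<Rightarrow> bool list set set" where
  "root_taken h = {D. almost_dominating h D \<and> [] \<in> D}"

definition root_covered :: "nat \<Rightarrow> bool list set set" where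
  "root_covered h = {D. almost_dominating h D \<and> [] \<notin> D \<and> (\<exists>b. [b] \<in> D)}"

definition root_uncovered :: "nat \<Rightarrow> bool list set set" where
  "root_uncovered h = {D. almost_dominating h D \<and> [] \<notin> D \<and> (\<forall>b. [b] \<notin> D)}"

lemmas root_defs = root_taken_def root_covered_def root_uncovered_def

lemma dominating_set_complete_binary_tree:
  "{D. dominating_set (complete_binary_tree h) D} = root_taken h \<union> root_covered h"
proof -
  have "dominating_set (complete_binary_tree h) D \<longleftrightarrow>
      almost_dominating h D \<and> ([] \<in> D \<or> (\<exists>b. [b] \<in> D))" (is "?dom \<longleftrightarrow> ?almost") for D
  proof
    assume ?dom
    then have sub: "D \<subseteq> {v. length v \<le> h}"
      and dom: "length v \<le> h \<Longrightarrow> v \<in> D \<or> (\<exists>u\<in>D. \<exists>b. v = b # u \<or> u = b # v)" for v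
      by (auto simp: dominating_set_def complete_binary_tree_def)
    show ?almost
      unfolding almost_dominating_def
    proof (intro conjI allI impI sub)
      fix v :: "bool list" assume "v \<noteq> [] \<and> length v \<le> h"
      then show "v \<in> D \<or> tl v \<in> D \<or> (\<exists>b. b # v \<in> D)"
        using dom[of v] by auto
    next
      show "[] \<in> D \<or> (\<exists>b. [b] \<in> D)"
        using dom[of "[]"] by auto
    qed
  next
    assume almost: ?almost
    then have sub: "D \<subseteq> {v. length v \<le> h}"
      by (simp add: almost_dominating_def)
    have "v \<in> D \<or> (\<exists>u\<in>D. \<exists>b. v = b # u \<or> u = b # v)" if "length v \<le> h" for v
    proof (cases v)
      case Nil
      then show ?thesis using almost by auto
    next
      case (Cons a w)
      then have "v \<in> D \<or> w \<in> D \<or> (\<exists>b. b # v \<in> D)"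
        using almost that unfolding almost_dominating_def by (metis list.sel(3) list.distinct(1))
      then show ?thesis using Cons by blast
    qed
    \<comment> \<open>Arcs need both ends in the tree; for \<open>u\<close> this holds because
      \<open>D\<close> lies in it.\<close>
    then have "\<exists>u\<in>D. length u \<le> h \<and> (\<exists>b. v = b # u \<or> u = b # v)"
      if "length v \<le> h" "v \<notin> D" for v
      using that sub by blast
    then show ?dom
      using sub by (auto simp: dominating_set_def complete_binary_tree_def)
  qed
  then show ?thesis
    by (auto simp: root_defs)
qed

section \<open>Recursion in the height\<close>

text \<open>For \<open>w \<noteq> []\<close> the parent and children of \<open>w @ [b]\<close> lie
  in the same subtree. For \<open>w = []\<close> the parent is the root of the whole tree, which
  accounts for the extra condition.\<close>

lemma almost_dominating_Suc:
  "almost_dominating (Suc h) D \<longleftrightarrow>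
     (\<forall>b. almost_dominating h (subtree b D) \<and>
       ([] \<in> D \<or> [] \<in> subtree b D \<or> (\<exists>c. [c] \<in> subtree b D)))"
proof -
  have sub: "D \<subseteq> {v. length v \<le> Suc h} \<longleftrightarrow> (\<forall>b. subtree b D \<subseteq> {v. length v \<le> h})"
  proof (intro iffI allI subsetI)
    fix v assume "\<forall>b. subtree b D \<subseteq> {v. length v \<le> h}" "v \<in> D"
    then show "v \<in> {v. length v \<le> Suc h}"
      by (cases v rule: rev_cases) (auto simp: subtree_def)
  qed (auto simp: subtree_def)
  let ?dom = "\<lambda>D (v :: bool list). v \<in> D \<or> tl v \<in> D \<or> (\<exists>b. b # v \<in> D)"
  have all: "(\<forall>v. v \<noteq> [] \<and> length v \<le> Suc h \<longrightarrow> ?dom D v) \<longleftrightarrow>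
      (\<forall>b w. length w \<le> h \<longrightarrow> ?dom D (w @ [b]))"
  proof (intro iffI allI impI)
    fix v :: "bool list" assume "\<forall>b w. length w \<le> h \<longrightarrow> ?dom D (w @ [b])" "v \<noteq> [] \<and> length v \<le> Suc h"
    then show "?dom D v"
      by (cases v rule: rev_cases) auto
  qed auto
  have Nil: "?dom D ([] @ [b]) \<longleftrightarrow> [] \<in> D \<or> [] \<in> subtree b D \<or> (\<exists>c. [c] \<in> subtree b D)" for b
    by (auto simp: subtree_def)
  have snoc: "?dom D (w @ [b]) \<longleftrightarrow> ?dom (subtree b D) w" if "w \<noteq> []" for b w
    using that by (simp add: subtree_def)
  have split: "(\<forall>w. length w \<le> h \<longrightarrow> P w) \<longleftrightarrow> (\<forall>w. w \<noteq> [] \<and> length w \<le> h \<longrightarrow> P w) \<and> P []"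
    for P :: "bool list \<Rightarrow> bool"
    by (metis le0 list.size(3))
  have "(\<forall>w. w \<noteq> [] \<and> length w \<le> h \<longrightarrow> ?dom D (w @ [b])) \<longleftrightarrow>
      (\<forall>w. w \<noteq> [] \<and> length w \<le> h \<longrightarrow> ?dom (subtree b D) w)" for b
    by (intro all_cong1 imp_cong refl snoc) simp
  then have "(\<forall>w. length w \<le> h \<longrightarrow> ?dom D (w @ [b])) \<longleftrightarrow>
      (\<forall>w. w \<noteq> [] \<and> length w \<le> h \<longrightarrow> ?dom (subtree b D) w) \<and>
      ([] \<in> D \<or> [] \<in> subtree b D \<or> (\<exists>c. [c] \<in> subtree b D))" for b
    by (simp only: split[of "\<lambda>w. ?dom D (w @ [b])"] Nil)
  then show ?thesis
    by (simp only: almost_dominating_def sub all) (simp only: all_conj_distrib conj_assoc)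
qed

lemma root_taken_Suc:
  "root_taken (Suc h) = join True `
     ((root_taken h \<union> root_covered h \<union> root_uncovered h) \<times>
      (root_taken h \<union> root_covered h \<union> root_uncovered h))"
  by (auto simp: root_defs almost_dominating_Suc image_join all_bool_eq)

text \<open>With the root outside \<open>D\<close>, an uncovered half would leave a child
  undominated. The requirement of at least one taken child is cut into disjoint products so that
  counts add.\<close>

lemma root_covered_Suc:
  "root_covered (Suc h) = join False ` (root_taken h \<times> root_taken h) \<union>
     (join False ` (root_taken h \<times> root_covered h) \<union>
      join False ` (root_covered h \<times> root_taken h))"
proof -
  have "[b] \<in> D \<longleftrightarrow> [] \<in> subtree b D" for b D
    by (simp add: subtree_def)
  then show ?thesis
    by (auto simp: root_defs almost_dominating_Suc image_join all_bool_eq ex_bool_eq)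
qed

text \<open>The children are neither taken nor dominated from above, so each must be covered from
  below.\<close>

lemma root_uncovered_Suc:
  "root_uncovered (Suc h) = join False ` (root_covered h \<times> root_covered h)"
proof -
  have "[b] \<in> D \<longleftrightarrow> [] \<in> subtree b D" for b D
    by (simp add: subtree_def)
  then show ?thesis
    by (auto simp: root_defs almost_dominating_Suc image_join all_bool_eq ex_bool_eq)
qed

lemma min_count_dominating:
  assumes "min_count (root_taken h) n j" "min_count (root_covered h) n k"
  shows "min_count {D. dominating_set (complete_binary_tree h) D} n (j + k)"
  unfolding dominating_set_complete_binary_tree
  by (rule min_count_Un[OF assms]) (auto simp: root_defs)

text \<open>All three classes are counted at the same \<open>n\<close>; one whose minimum is larger
  enters with 0.\<close>

lemma min_count_root_taken_Suc:
  assumes "min_count (root_taken h) n i" "min_count (root_covered h) n j"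
    "min_count (root_uncovered h) n k"
  shows "min_count (root_taken (Suc h)) (2 * n + 1) ((i + j + k)\<^sup>2)"
proof -
  have "min_count (root_taken h \<union> root_covered h \<union> root_uncovered h) n (i + j + k)"
    by (intro min_count_Un assms) (auto simp: root_defs)
  from min_count_join[OF this this, of True] show ?thesis
    by (simp add: root_taken_Suc power2_eq_square mult_2)
qed

text \<open>The assumptions concern the products rather than the classes, since the natural bounds
  of the products can differ.\<close>

lemma min_count_root_covered_Suc:
  assumes "min_count (join False ` (root_taken h \<times> root_taken h)) n i"
    and "min_count (join False ` (root_taken h \<times> root_covered h)) n j"
    and "min_count (join False ` (root_covered h \<times> root_taken h)) n k"
  shows "min_count (root_covered (Suc h)) n (i + (j + k))"
  unfolding root_covered_Suc
  by (intro min_count_Un assms) (auto simp: image_join root_defs)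

lemma min_count_root_uncovered_Suc:
  assumes "min_count (root_covered h) n k"
  shows "min_count (root_uncovered (Suc h)) (2 * n) (k\<^sup>2)"
  using min_count_join[OF assms assms, of False]
  by (simp add: root_uncovered_Suc power2_eq_square mult_2)

section \<open>Solving the recursion modulo 3\<close>

text \<open>\<open>root_covered 0\<close> is empty, so its bound is vacuous; 1 fits the pattern
  \<open>q + 1, q + 1, q\<close> with \<open>q = 0\<close>.\<close>

lemma min_count_height_0:
  "min_count (root_taken 0) 1 1" "min_count (root_covered 0) 1 0" "min_count (root_uncovered 0) 0 1"
proof -
  have "root_taken 0 = {{[]}}" "root_covered 0 = {}" "root_uncovered 0 = {{}}"
    by (auto simp: root_defs almost_dominating_def)
  moreover have "{D. D = {[]} \<and> card D = 1} = {{[] :: bool list}}"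
    "{D. D = {} \<and> card D = 0} = {{} :: bool list set}"
    by auto
  ultimately show
    "min_count (root_taken 0) 1 1" "min_count (root_covered 0) 1 0" "min_count (root_uncovered 0) 0 1"
    by (simp_all add: min_count_def)
qed

text \<open>Only uncovered halves have size \<open>q\<close>, and only a taken root admits them; all
  other products have size at least \<open>2 * q + 2\<close>. The count \<open>c\<close> stays open
  to allow both 0 at height 0 and 2 later.\<close>

lemma min_count_step_0_1:
  assumes "min_count (root_taken h) (q + 1) 1" "min_count (root_covered h) (q + 1) c"
    "min_count (root_uncovered h) q 1"
  shows "min_count (root_taken (Suc h)) (2 * q + 1) 1"
    "min_count (root_covered (Suc h)) (2 * q + 1) 0"
    "min_count (root_uncovered (Suc h)) (2 * q + 1) 0"
proof -
  note low = min_count_less[OF assms(1), of q] min_count_less[OF assms(2), of q]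
  show "min_count (root_taken (Suc h)) (2 * q + 1) 1"
    using min_count_root_taken_Suc[OF low assms(3)] by simp
  have "min_count (join False ` (root_taken h \<times> root_taken h)) (2 * q + 1) 0"
    "min_count (join False ` (root_taken h \<times> root_covered h)) (2 * q + 1) 0"
    "min_count (join False ` (root_covered h \<times> root_taken h)) (2 * q + 1) 0"
    by (rule min_count_less[OF min_count_join], rule assms, rule assms, simp)+
  from min_count_root_covered_Suc[OF this]
  show "min_count (root_covered (Suc h)) (2 * q + 1) 0"
    by simp
  show "min_count (root_uncovered (Suc h)) (2 * q + 1) 0"
    by (rule min_count_less[OF min_count_root_uncovered_Suc[OF assms(2)]]) simp
qed

text \<open>Only taken halves attain \<open>g\<close>, and two of them cover the root without its
  being taken.\<close>

lemma min_count_step_1_2: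
  assumes "min_count (root_taken h) g 1" "min_count (root_covered h) g 0"
    "min_count (root_uncovered h) g 0"
  shows "min_count (root_taken (Suc h)) (2 * g + 1) 1"
    "min_count (root_covered (Suc h)) (2 * g) 1"
    "min_count (root_uncovered (Suc h)) (2 * g) 0"
  using min_count_root_taken_Suc[OF assms] min_count_root_uncovered_Suc[OF assms(2)]
    min_count_root_covered_Suc[OF min_count_join[OF assms(1,1)] min_count_join[OF assms(1,2)]
      min_count_join[OF assms(2,1)]]
  by (simp_all add: mult_2)

text \<open>Covered halves are now the cheapest. The count 2 arises because covering the root costs
  one extra vertex, in either half; taking both children would cost two.\<close>

lemma min_count_step_2_0:
  assumes "min_count (root_taken h) (g + 1) 1" "min_count (root_covered h) g 1"
    "min_count (root_uncovered h) g 0"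
  shows "min_count (root_taken (Suc h)) (2 * g + 1) 1"
    "min_count (root_covered (Suc h)) (2 * g + 1) 2"
    "min_count (root_uncovered (Suc h)) (2 * g) 1"
proof -
  show "min_count (root_taken (Suc h)) (2 * g + 1) 1"
    using min_count_root_taken_Suc[OF min_count_less[OF assms(1), of g] assms(2,3)] by simp
  have "min_count (join False ` (root_taken h \<times> root_taken h)) (2 * g + 1) 0"
    by (rule min_count_less[OF min_count_join[OF assms(1,1)]]) simp
  moreover have "min_count (join False ` (root_taken h \<times> root_covered h)) (2 * g + 1) 1"
    "min_count (join False ` (root_covered h \<times> root_taken h)) (2 * g + 1) 1"
    using min_count_join[OF assms(1,2), of False] min_count_join[OF assms(2,1), of False]
    by (simp_all add: mult_2)
  ultimately have "min_count (root_covered (Suc h)) (2 * g + 1) (0 + (1 + 1))"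
    by (rule min_count_root_covered_Suc)
  then show "min_count (root_covered (Suc h)) (2 * g + 1) 2"
    by (simp add: numeral_2_eq_2)
  show "min_count (root_uncovered (Suc h)) (2 * g) 1"
    using min_count_root_uncovered_Suc[OF assms(2)] by simp
qed

lemma min_count_height_3k:
  "\<exists>q. 7 * q + 4 = 2 ^ (3 * k + 2) \<and>
     min_count (root_taken (3 * k)) (q + 1) 1 \<and>
     min_count (root_covered (3 * k)) (q + 1) (if k = 0 then 0 else 2) \<and>
     min_count (root_uncovered (3 * k)) q 1"
proof (induction k)
  case 0
  show ?case
    by (rule exI[of _ 0]) (use min_count_height_0 in simp)
next
  case (Suc k)
  then obtain q where q: "7 * q + 4 = 2 ^ (3 * k + 2)"
    and *: "min_count (root_taken (3 * k)) (q + 1) 1"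
      "min_count (root_covered (3 * k)) (q + 1) (if k = 0 then 0 else 2)"
      "min_count (root_uncovered (3 * k)) q 1"
    by blast
  have Suc3: "3 * Suc k = Suc (Suc (Suc (3 * k)))"
    by simp
  \<comment> \<open>The three steps send \<open>q\<close> to \<open>2 * q + 1\<close>, then double
    twice, giving \<open>8 * q + 4\<close>; hence \<open>7 * q + 4\<close> is multiplied by
    8.\<close>
  have pow: "7 * (2 * (2 * (2 * q + 1))) + 4 = (2 ^ (3 * Suc k + 2) :: nat)"
    using q by (simp add: power_add power_mult)
  show ?case
    using min_count_step_2_0[OF min_count_step_1_2[OF min_count_step_0_1[OF *]]] pow
    unfolding Suc3 by (intro exI[of _ "2 * (2 * (2 * q + 1))"] conjI) simp_all
qed

theorem theorem10:
  fixes h :: nat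
  assumes "h \<ge> 1"
  shows "int (domination_number (complete_binary_tree h)) = \<lfloor>(2 ^ (h + 2) + 3) / 7 :: real\<rfloor> \<and>
      dominion (complete_binary_tree h) = (if h mod 3 = 0 \<and> h \<ge> 3 then 3 else 1)"
proof -
  define k where "k = h div 3"
  obtain q where q: "7 * q + 4 = 2 ^ (3 * k + 2)"
    and *: "min_count (root_taken (3 * k)) (q + 1) 1"
      "min_count (root_covered (3 * k)) (q + 1) (if k = 0 then 0 else 2)"
      "min_count (root_uncovered (3 * k)) q 1"
    using min_count_height_3k by blast
  note step1 = min_count_step_0_1[OF *]
  note step2 = min_count_step_1_2[OF step1]
  let ?\<zeta> = "if h mod 3 = 0 \<and> h \<ge> 3 then 3 else 1 :: nat"
  have "h mod 3 < 3" "h = 3 * k + h mod 3"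
    by (simp_all add: k_def)
  then consider "h = 3 * k" "k > 0" | "h = Suc (3 * k)" | "h = Suc (Suc (3 * k))"
    using assms by linarith
  \<comment> \<open>The bounds state the floor without division: \<open>2 ^ (h + 2) + 3\<close>
    exceeds \<open>7 * n\<close> by 0, 4 and 5 in the three cases.\<close>
  then obtain n where n: "min_count {D. dominating_set (complete_binary_tree h) D} n ?\<zeta>"
    and bounds: "7 * n \<le> 2 ^ (h + 2) + 3" "2 ^ (h + 2) + 3 < 7 * n + 7"
  proof cases
    case 1
    then have "1 + (if k = 0 then 0 else 2) = ?\<zeta>"
      by simp
    then have "min_count {D. dominating_set (complete_binary_tree h) D} (q + 1) ?\<zeta>"
      using min_count_dominating[OF *(1,2), folded 1(1)] by (simp only:)
    moreover have "2 ^ (h + 2) = 7 * q + 4"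
      using q 1 by simp
    ultimately show thesis
      by (intro that[of "q + 1"]) simp_all
  next
    case 2
    then have "h mod 3 = 1" by presburger
    then have "min_count {D. dominating_set (complete_binary_tree h) D} (2 * q + 1) ?\<zeta>"
      using min_count_dominating[OF step1(1,2), folded 2] by simp
    moreover have "2 ^ (h + 2) = 2 * (7 * q + 4)"
      unfolding q 2 by simp
    ultimately show thesis
      by (intro that[of "2 * q + 1"]) simp_all
  next
    case 3
    then have "h mod 3 = 2" by presburger
    then have "min_count {D. dominating_set (complete_binary_tree h) D} (2 * (2 * q + 1)) ?\<zeta>"
      \<comment> \<open>The taken class starts one above the covered class, so it contributes 0
        here.\<close>
      using min_count_dominating[OF min_count_less[OF step2(1)] step2(2), folded 3] by simp
    moreover have "2 ^ (h + 2) = 4 * (7 * q + 4)"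
      unfolding q 3 by simp
    ultimately show thesis
      by (intro that[of "2 * (2 * q + 1)"]) simp_all
  qed
  have "\<lfloor>(2 ^ (h + 2) + 3) / 7 :: real\<rfloor> = int n"
  proof (rule floor_unique)
    have "real (7 * n) \<le> real (2 ^ (h + 2) + 3)" "real (2 ^ (h + 2) + 3) < real (7 * n + 7)"
      using bounds by (simp_all only: of_nat_le_iff of_nat_less_iff)
    then show "of_int (int n) \<le> (2 ^ (h + 2) + 3) / (7 :: real)"
      "(2 ^ (h + 2) + 3) / (7 :: real) < of_int (int n) + 1"
      by simp_all
  qed
  then show ?thesis
    using domination_number_dominion_eqI[OF n] by simp
qed

end
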